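(* (i) The eigenvalues of Gram matrices give the golden ratio. (ii) The eigenvalues $\lambda_1,\lambda_2$ of the matrices $A$ and $B$ satisfy the following invariant equalities: $$|\lambda_1\cdot\lambda_2|=1,\qquad \lambda_1+\lambda_2=\mp 1,\qquad \frac{\lambda_1}{\lambda_2}=-\varphi^2 .$$
   Context: $\mathbb{H}$ denotes the set of hybrid numbers $\{a+b_1h^1+b_2h^2+b_3h^3 : a,b_1,b_2,b_3\in\mathbb{R}\}$, i.e. the real vector space with basis $1,h^1,h^2,h^3$ (superscripts are indices, not powers), with the $\mathbb{R}$-bilinear multiplication having unit $1$ and determined by $h^1h^1=-1$, $h^1h^2=1-h^3$, $h^1h^3=h^1+h^2$, $h^2h^1=1+h^3$, $h^2h^2=0$, $h^2h^3=-h^2$, $h^3h^1=-h^1-h^2$, $h^3h^2=h^2$, $h^3h^3=1$. $\mathrm{Re}(a+b_1h^1+b_2h^2+b_3h^3)=a$. For $Z=a+b_1h^1+b_2h^2+b_3h^3$ the conjugates are: (ordinary) conjugate $\bar Z=a-b_1h^1-b_2h^2-b_3h^3$; complex conjugate $\bar Z^{\mathbb{C}}=a-b_1h^1+b_2h^2+b_3h^3$; hyperbolic conjugate $\bar Z^{\mathbb{H}}=a+b_1h^1+b_2h^2-b_3h^3$; anti conjugate $\bar Z^{A}=-a+b_1h^1+b_2h^2+b_3h^3$. For a given one of these conjugations and the basis $(e_1,e_2,e_3,e_4)=(1,h^1,h^2,h^3)$, the Gram matrix is $G=(G_{ij})$ with $G_{ij}=\mathrm{Re}(e_i\cdot\bar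 e_j)$, where $\bar e_j$ is the basis element to which that conjugation has been applied. For the ordinary, complex, hyperbolic and anti conjugations respectively, the Gram matrices are $$G_O=\begin{bmatrix}1&0&0&0\\0&1&-1&0\\0&-1&0&0\\0&0&0&-1\end{bmatrix},\quad G_{\mathbb{C}}=\begin{bmatrix}1&0&0&0\\0&1&1&0\\0&-1&0&0\\0&0&0&1\end{bmatrix},$$ $$G_{\mathbb{H}}=\begin{bmatrix}1&0&0&0\\0&-1&1&0\\0&1&0&0\\0&0&0&-1\end{bmatrix},\quad G_A=\begin{bmatrix}-1&0&0&0\\0&-1&1&0\\0&1&0&0\\0&0&0&1\end{bmatrix}.$$ In terms of the $h^1$-$h^2$ subblock (rows and columns 2 and 3), each of $G_O$, $G_{\mathbb{H}}$, $G_A$ contains one of the two blocks $$A=\begin{bmatrix}1&-1\\-1&0\end{bmatrix},\qquad B=\begin{bmatrix}-1&1\\1&0\end{bmatrix}.$$ The golden ratio is $\varphi=\frac{1+\sqrt5}{2}$. The eigenvalues are labelled $\lambda_1=\varphi$, $\lambda_2=-\frac1\varphi$ for $A$, and $\lambda_1=-\varphi$, $\lambda_2=\frac1\varphi$ for $B$. *)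

theory Defs
  imports Complex_Main "Jordan_Normal_Form.Spectral_Radius"
begin

datatype hybrid = Hybrid (re: real) (im1: real) (im2: real) (im3: real)

lemma hybrid_eq_iff:
  "x = y \<longleftrightarrow> re x = re y \<and> im1 x = im1 y \<and> im2 x = im2 y \<and> im3 x = im3 y"
  by (cases x; cases y) simp

instantiation hybrid :: real_algebra_1
begin

definition "0 = Hybrid 0 0 0 0"

definition "1 = Hybrid 1 0 0 0"

definition "x + y = Hybrid (re x + re y) (im1 x + im1 y) (im2 x + im2 y) (im3 x + im3 y)"

definition "- x = Hybrid (- re x) (- im1 x) (- im2 x) (- im3 x)"

definition "x - y = Hybrid (re x - re y) (im1 x - im1 y) (im2 x - im2 y) (im3 x - im3 y)"

definition "r *\<^sub>R x = Hybrid (r * re x) (r * im1 x) (r * im2 x) (r * im3 x)"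

(* bilinear extension of the multiplication table proved below as hybrid_mult_table *)
definition
  "x * y = Hybrid
     (re x * re y - im1 x * im1 y + im1 x * im2 y + im2 x * im1 y + im3 x * im3 y)
     (re x * im1 y + im1 x * re y + im1 x * im3 y - im3 x * im1 y)
     (re x * im2 y + im2 x * re y + im1 x * im3 y - im3 x * im1 y
        - im2 x * im3 y + im3 x * im2 y)
     (re x * im3 y + im3 x * re y - im1 x * im2 y + im2 x * im1 y)"

instance
  by standard
     (simp_all add: hybrid_eq_iff zero_hybrid_def one_hybrid_def plus_hybrid_def
        uminus_hybrid_def minus_hybrid_def scaleR_hybrid_def times_hybrid_def algebra_simps)

end

definition h1 :: hybrid where "h1 = Hybrid 0 1 0 0"
definition h2 :: hybrid where "h2 = Hybrid 0 0 1 0"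
definition h3 :: hybrid where "h3 = Hybrid 0 0 0 1"

lemmas hybrid_defs = zero_hybrid_def one_hybrid_def plus_hybrid_def uminus_hybrid_def
  minus_hybrid_def scaleR_hybrid_def times_hybrid_def h1_def h2_def h3_def

lemma hybrid_expansion: "Hybrid a b c d = a *\<^sub>R 1 + b *\<^sub>R h1 + c *\<^sub>R h2 + d *\<^sub>R h3"
  by (simp add: hybrid_defs)

lemma hybrid_mult_table:
  "h1 * h1 = - 1"      "h1 * h2 = 1 - h3"  "h1 * h3 = h1 + h2"
  "h2 * h1 = 1 + h3"   "h2 * h2 = 0"       "h2 * h3 = - h2"
  "h3 * h1 = - h1 - h2" "h3 * h2 = h2"     "h3 * h3 = 1"
  by (simp_all add: hybrid_defs)

definition conj_ordinary :: "hybrid \<Rightarrow> hybrid" where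
  "conj_ordinary z = Hybrid (re z) (- im1 z) (- im2 z) (- im3 z)"

definition conj_complex :: "hybrid \<Rightarrow> hybrid" where
  "conj_complex z = Hybrid (re z) (- im1 z) (im2 z) (im3 z)"

definition conj_hyperbolic :: "hybrid \<Rightarrow> hybrid" where
  "conj_hyperbolic z = Hybrid (re z) (im1 z) (im2 z) (- im3 z)"

definition conj_anti :: "hybrid \<Rightarrow> hybrid" where
  "conj_anti z = Hybrid (- re z) (im1 z) (im2 z) (im3 z)"

definition hybrid_basis :: "hybrid list" where
  "hybrid_basis = [1, h1, h2, h3]"

definition gram :: "(hybrid \<Rightarrow> hybrid) \<Rightarrow> real mat" where
  "gram c = mat 4 4 (\<lambda>(i, j). re (hybrid_basis ! i * c (hybrid_basis ! j)))"

definition block_A :: "real mat" where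
  "block_A = mat_of_rows_list 2 [[1, -1], [-1, 0]]"

definition block_B :: "real mat" where
  "block_B = mat_of_rows_list 2 [[-1, 1], [1, 0]]"

definition golden_ratio :: real where
  "golden_ratio = (1 + sqrt 5) / 2"

lemma gram_ordinary:
  "gram conj_ordinary = mat_of_rows_list 4 [[1,0,0,0],[0,1,-1,0],[0,-1,0,0],[0,0,0,-1]]"
  by (rule eq_matI)
     (auto simp: gram_def mat_of_rows_list_def hybrid_basis_def conj_ordinary_def hybrid_defs
        less_Suc_eq numeral_eq_Suc)

lemma gram_complex:
  "gram conj_complex = mat_of_rows_list 4 [[1,0,0,0],[0,1,1,0],[0,-1,0,0],[0,0,0,1]]"
  by (rule eq_matI)
     (auto simp: gram_def mat_of_rows_list_def hybrid_basis_def conj_complex_def hybrid_defs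
        less_Suc_eq numeral_eq_Suc)

lemma gram_hyperbolic:
  "gram conj_hyperbolic = mat_of_rows_list 4 [[1,0,0,0],[0,-1,1,0],[0,1,0,0],[0,0,0,-1]]"
  by (rule eq_matI)
     (auto simp: gram_def mat_of_rows_list_def hybrid_basis_def conj_hyperbolic_def hybrid_defs
        less_Suc_eq numeral_eq_Suc)

lemma gram_anti:
  "gram conj_anti = mat_of_rows_list 4 [[-1,0,0,0],[0,-1,1,0],[0,1,0,0],[0,0,0,1]]"
  by (rule eq_matI)
     (auto simp: gram_def mat_of_rows_list_def hybrid_basis_def conj_anti_def hybrid_defs
        less_Suc_eq numeral_eq_Suc)

(* Matrix indices start at 0: the basis elements h1, h2 have indices 1, 2. *)
definition h1_h2_block :: "real mat \<Rightarrow> real mat" where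
  "h1_h2_block G = mat 2 2 (\<lambda>(i, j). G $$ (i + 1, j + 1))"

lemma h1_h2_blocks:
  "h1_h2_block (gram conj_ordinary) = block_A"
  "h1_h2_block (gram conj_hyperbolic) = block_B"
  "h1_h2_block (gram conj_anti) = block_B"
  by (auto simp: h1_h2_block_def gram_ordinary gram_hyperbolic gram_anti
        block_A_def block_B_def mat_of_rows_list_def less_Suc_eq numeral_eq_Suc
        intro!: eq_matI)

end

theory Submission
  imports Defs
begin

text \<open>
  Each of the three Gram matrices is block diagonal with blocks of sizes 1, 2, 1, the outer
  blocks being \<open>1\<close> and \<open>-1\<close> in some order and the middle one \<open>A\<close> or \<open>B\<close>. Hence its spectrum is the
  union of \<open>{1, -1}\<close> with the roots of \<open>x\<^sup>2 - x - 1\<close> or \<open>x\<^sup>2 + x - 1\<close>.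
\<close>

text \<open>Laplace expansion along the first row: the two minors are the single entries of the
  second row.\<close>

lemma det_2x2:
  fixes A :: "'a :: comm_ring_1 mat"
  assumes "A \<in> carrier_mat 2 2"
  shows "det A = A $$ (0,0) * A $$ (1,1) - A $$ (0,1) * A $$ (1,0)"
proof -
  have "det A = (\<Sum>j<2. A $$ (0,j) * cofactor A 0 j)"
    by (rule laplace_expansion_row[OF assms]) simp
  moreover have "mat_delete A 0 j \<in> carrier_mat 1 1" for j
    using mat_delete_carrier[OF assms[unfolded numeral_2_eq_2]] by simp
  moreover have "mat_delete A 0 0 $$ (0,0) = A $$ (1,1)" "mat_delete A 0 1 $$ (0,0) = A $$ (1,0)"
    using assms by (auto simp: mat_delete_def)
  ultimately show ?thesis
    by (simp add: cofactor_def det_single lessThan_Suc numeral_2_eq_2)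
qed

lemma spectrum_1x1:
  fixes A :: "'a :: field mat"
  assumes "A \<in> carrier_mat 1 1"
  shows "spectrum A = {A $$ (0,0)}"
proof -
  have "eigenvalue A k \<longleftrightarrow> k = A $$ (0,0)" for k
    using assms det_single[of "char_matrix A k"] by (auto simp: eigenvalue_det char_matrix_def)
  then show ?thesis
    by (auto simp: spectrum_def)
qed

text \<open>The equation says that the determinant of \<open>A - k I\<close> vanishes. Stating it
  through entries lets it apply to a concrete block directly.\<close>

lemma spectrum_2x2:
  fixes A :: "'a :: field mat"
  assumes "A \<in> carrier_mat 2 2"
  shows "spectrum A = {k. (A $$ (0,0) - k) * (A $$ (1,1) - k) = A $$ (0,1) * A $$ (1,0)}"
proof -
  have "eigenvalue A k \<longleftrightarrow> (A $$ (0,0) - k) * (A $$ (1,1) - k) = A $$ (0,1) * A $$ (1,0)" for k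
    using assms det_2x2[of "char_matrix A k"]
    by (auto simp: eigenvalue_det char_matrix_def)
  then show ?thesis
    by (auto simp: spectrum_def)
qed

text \<open>Subtracting \<open>k I\<close> preserves the block diagonal shape, so the determinant
  factors over the two blocks; in a field the product vanishes iff one factor does.\<close>

lemma spectrum_four_block_diag:
  fixes A D :: "'a :: field mat"
  assumes A: "A \<in> carrier_mat n n" and D: "D \<in> carrier_mat m m"
  shows "spectrum (four_block_mat A (0\<^sub>m n m) (0\<^sub>m m n) D) = spectrum A \<union> spectrum D"
proof -
  let ?M = "four_block_mat A (0\<^sub>m n m) (0\<^sub>m m n) D"
  have M: "?M \<in> carrier_mat (n + m) (n + m)"
    using A D by simp
  have "char_matrix ?M k = four_block_mat (char_matrix A k) (0\<^sub>m n m) (0\<^sub>m m n) (char_matrix D k)" for k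
    using A D by (intro eq_matI) (auto simp: char_matrix_def)
  then have "det (char_matrix ?M k) = det (char_matrix A k) * det (char_matrix D k)" for k
    using A D by (simp add: det_four_block_mat_lower_left_zero[of _ n _ m])
  then have "eigenvalue ?M k \<longleftrightarrow> eigenvalue A k \<or> eigenvalue D k" for k
    using eigenvalue_det[OF M] eigenvalue_det[OF A] eigenvalue_det[OF D] by simp
  then show ?thesis
    by (auto simp: spectrum_def)
qed

lemma spectrum_diag_block_mat:
  fixes As :: "'a :: field mat list"
  assumes "\<forall>A\<in>set As. square_mat A"
  shows "spectrum (diag_block_mat As) = (\<Union>A\<in>set As. spectrum A)"
  using assms
proof (induction As)
  case Nil
  \<comment> \<open>A 0 by 0 determinant is 1, never 0, so the empty block matrix has empty
    spectrum.\<close>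
  have "char_matrix (0\<^sub>m 0 0 :: 'a mat) k \<in> carrier_mat 0 0" for k
    by (simp add: char_matrix_def)
  then show ?case
    by (auto simp: spectrum_def eigenvalue_det[of _ 0])
next
  case (Cons A As)
  define n where "n = dim_row A"
  define m where "m = dim_row (diag_block_mat As)"
  have "A \<in> carrier_mat n n" "diag_block_mat As \<in> carrier_mat m m"
    using Cons.prems diag_block_mat_square[of As] by (auto simp: n_def m_def)
  then show ?case
    using Cons by (simp add: Let_def spectrum_four_block_diag)
qed

lemma block_carrier:
  "block_A \<in> carrier_mat 2 2" "block_B \<in> carrier_mat 2 2"
  by (rule carrier_matI; simp add: block_A_def block_B_def mat_of_rows_list_def)+

lemma gram_diag_block:
  "gram conj_ordinary = diag_block_mat [mat 1 1 (\<lambda>_. 1), block_A, mat 1 1 (\<lambda>_. - 1)]"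
  "gram conj_hyperbolic = diag_block_mat [mat 1 1 (\<lambda>_. 1), block_B, mat 1 1 (\<lambda>_. - 1)]"
  "gram conj_anti = diag_block_mat [mat 1 1 (\<lambda>_. - 1), block_B, mat 1 1 (\<lambda>_. 1)]"
  by (auto simp: gram_ordinary gram_hyperbolic gram_anti block_A_def block_B_def
      mat_of_rows_list_def Let_def less_Suc_eq numeral_eq_Suc intro!: eq_matI)

lemma golden_ratio_pos: "golden_ratio > 0"
  by (simp add: golden_ratio_def add_pos_nonneg)

text \<open>The only place where \<open>sqrt 5\<close> is computed with; apart from positivity, the
  golden ratio enters below only as a root of this quadratic.\<close>

lemma golden_ratio_square: "golden_ratio\<^sup>2 = golden_ratio + 1"
  by (simp add: golden_ratio_def power2_eq_square field_simps)

text \<open>Dividing the quadratic relation by \<open>golden_ratio\<close> makes the reciprocals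
  affine in \<open>golden_ratio\<close>, which suits ring normalisation and linear
  arithmetic.\<close>

lemma inverse_golden_ratio:
  "1 / golden_ratio = golden_ratio - 1" "- 1 / golden_ratio = 1 - golden_ratio"
  using golden_ratio_pos golden_ratio_square by (simp_all add: field_simps power2_eq_square)

lemma spectrum_block_A: "spectrum block_A = {golden_ratio, - 1 / golden_ratio}"
proof -
  have "k \<in> spectrum block_A \<longleftrightarrow> k = golden_ratio \<or> k = 1 - golden_ratio" for k
  proof -
    have "k \<in> spectrum block_A \<longleftrightarrow> k * k - k - 1 = 0"
      \<comment> \<open>\<open>block_A\<close> stays folded in the first call so that
        \<open>block_carrier\<close> discharges the dimension premise; only then are its entries
        computed.\<close>
      by (simp add: spectrum_2x2 block_carrier) (simp add: block_A_def mat_of_rows_list_def algebra_simps)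
    \<comment> \<open>Vieta: the two roots have sum 1, and their product
      \<open>golden_ratio - golden_ratio\<^sup>2\<close> is -1.\<close>
    also have "k * k - k - 1 = (k - (golden_ratio)) * (k - (1 - golden_ratio))"
      using golden_ratio_square by (simp add: algebra_simps power2_eq_square)
    also have "\<dots> = 0 \<longleftrightarrow> k = golden_ratio \<or> k = 1 - golden_ratio"
      by auto
    finally show ?thesis .
  qed
  then show ?thesis
    unfolding inverse_golden_ratio by blast
qed

lemma spectrum_block_B: "spectrum block_B = {- golden_ratio, 1 / golden_ratio}"
proof -
  have "k \<in> spectrum block_B \<longleftrightarrow> k = - golden_ratio \<or> k = golden_ratio - 1" for k
  proof -
    have "k \<in> spectrum block_B \<longleftrightarrow> k * k + k - 1 = 0"
      by (simp add: spectrum_2x2 block_carrier) (simp add: block_B_def mat_of_rows_list_def algebra_simps)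
    \<comment> \<open>These are the negatives of the roots for \<open>block_A\<close>: the sum
      becomes -1 and the product remains -1.\<close>
    also have "k * k + k - 1 = (k - (- golden_ratio)) * (k - (golden_ratio - 1))"
      using golden_ratio_square by (simp add: algebra_simps power2_eq_square)
    also have "\<dots> = 0 \<longleftrightarrow> k = - golden_ratio \<or> k = golden_ratio - 1"
      by auto
    finally show ?thesis .
  qed
  then show ?thesis
    unfolding inverse_golden_ratio by blast
qed

theorem corollary3p2:
  shows
    "(spectrum (gram conj_ordinary) = {1, - 1, golden_ratio, - 1 / golden_ratio} \<and>
      spectrum (gram conj_hyperbolic) = {1, - 1, - golden_ratio, 1 / golden_ratio} \<and>
      spectrum (gram conj_anti) = {1, - 1, - golden_ratio, 1 / golden_ratio}) \<and>
     (let l1 = golden_ratio; l2 = - 1 / golden_ratio in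
        spectrum block_A = {l1, l2} \<and>
        \<bar>l1 * l2\<bar> = 1 \<and> l1 + l2 = 1 \<and> l1 / l2 = - (golden_ratio\<^sup>2)) \<and>
     (let l1 = - golden_ratio; l2 = 1 / golden_ratio in
        spectrum block_B = {l1, l2} \<and>
        \<bar>l1 * l2\<bar> = 1 \<and> l1 + l2 = - 1 \<and> l1 / l2 = - (golden_ratio\<^sup>2))"
proof -
  have "square_mat block_A" "square_mat block_B"
    using block_carrier by auto
  then have
    "spectrum (gram conj_ordinary) = {1, - 1, golden_ratio, - 1 / golden_ratio}"
    "spectrum (gram conj_hyperbolic) = {1, - 1, - golden_ratio, 1 / golden_ratio}"
    "spectrum (gram conj_anti) = {1, - 1, - golden_ratio, 1 / golden_ratio}"
    unfolding gram_diag_block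
    \<comment> \<open>Unfolding \<open>diag_block_mat\<close> into nested four-block matrices would
      keep \<open>spectrum_diag_block_mat\<close> from matching.\<close>
    by (auto simp del: diag_block_mat.simps
        simp: spectrum_diag_block_mat spectrum_1x1 spectrum_block_A spectrum_block_B)
  moreover have "golden_ratio \<noteq> 0"
    using golden_ratio_pos by simp
  moreover from this have "\<bar>golden_ratio * (- 1 / golden_ratio)\<bar> = 1" "\<bar>- golden_ratio * (1 / golden_ratio)\<bar> = 1"
    "golden_ratio / (- 1 / golden_ratio) = - (golden_ratio\<^sup>2)"
    "- golden_ratio / (1 / golden_ratio) = - (golden_ratio\<^sup>2)"
    by (simp_all add: power2_eq_square)
  moreover have "golden_ratio + - 1 / golden_ratio = 1" "- golden_ratio + 1 / golden_ratio = - 1"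
    using inverse_golden_ratio by linarith+
  ultimately show ?thesis
    unfolding Let_def by (intro conjI spectrum_block_A spectrum_block_B)
qed

end
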